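(* Let $\alpha,\gamma$ be nonzero real numbers with $$0\le\alpha\le(2^{1/3}-1)^{1/4}\,\gamma .$$ Then for every positive integer $n$ divisible by $3$, the maximal value of the permanent on $\widehat{\Lambda}_n(\alpha,\gamma-\alpha,\gamma)$ is $$M_n(\alpha,\gamma-\alpha,\gamma)=2^{n/3}\gamma^n.$$
   Context: For real $\alpha,\beta,\gamma$, $\Lambda_n(\alpha,\beta,\gamma)$ is the class of $n\times n$ matrices containing each of $\alpha,\beta,\gamma$ exactly once in each row and in each column, all other entries being $0$ (i.e. matrices $\alpha A+\beta B+\gamma C$ with $A,B,C$ permutation matrices with pairwise disjoint supports). $\widehat{\Lambda}_n(\alpha,\beta,\gamma)$ is the subclass of those matrices with $\beta$'s on the main diagonal and with symmetric positions of $\alpha$ and $\gamma$ ($\alpha$ is placed at $(i,j)$ if and only if $\gamma$ is placed at $(j,i)$); equivalently, the set of matrices $\alpha S^{-1}+\beta I_n+\gamma S$, where $S$ is the permutation matrix of a permutation of $\{1,\dots,n\}$ all of whose cycles have length at least $3$. $M_n(\alpha,\beta,\gamma)$ denotes the maximum of the permanent over $\widehat{\Lambda}_n(\alpha,\beta,\gamma)$. Here $\beta=\gamma-\alpha$. *)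

theory Defs
  imports Complex_Main "HOL-Combinatorics.Orbits" "Jordan_Normal_Form.Matrix"
begin

text \<open>Indices run over \<open>{0..<n}\<close> instead of \<open>{1..n}\<close>. Like \<open>det\<close>, the permanent is \<open>0\<close>
  by convention on matrices that are not square.\<close>

definition permanent :: "'a :: comm_semiring_1 mat \<Rightarrow> 'a" where
  "permanent A = (if dim_row A = dim_col A
     then (\<Sum>p | p permutes {0..<dim_row A}. \<Prod>i = 0..<dim_row A. A $$ (i, p i)) else 0)"

definition perm_mat :: "nat \<Rightarrow> (nat \<Rightarrow> nat) \<Rightarrow> real mat" where
  "perm_mat n p = mat n n (\<lambda>(i, j). if j = p i then 1 else 0)"

definition permutation_matrices :: "nat \<Rightarrow> real mat set" where
  "permutation_matrices n = {perm_mat n p | p. p permutes {0..<n}}"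

definition mat_support :: "'a :: zero mat \<Rightarrow> (nat \<times> nat) set" where
  "mat_support A = {(i, j). i < dim_row A \<and> j < dim_col A \<and> A $$ (i, j) \<noteq> 0}"

text \<open>The 0/1 matrices \<open>A, B, C\<close> record where \<open>\<alpha>, \<beta>, \<gamma>\<close> are placed. Speaking of positions
  instead of entry values keeps the classes below meaningful when some of the three numbers
  coincide (for instance \<open>\<alpha> = \<beta>\<close>) or vanish.\<close>

definition placement :: "nat \<Rightarrow> real mat \<Rightarrow> real mat \<Rightarrow> real mat \<Rightarrow> bool" where
  "placement n A B C \<longleftrightarrow>
     A \<in> permutation_matrices n \<and> B \<in> permutation_matrices n \<and> C \<in> permutation_matrices n \<and>
     mat_support A \<inter> mat_support B = {} \<and> mat_support A \<inter> mat_support C = {} \<and>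
     mat_support B \<inter> mat_support C = {}"

definition Lambda :: "nat \<Rightarrow> real \<Rightarrow> real \<Rightarrow> real \<Rightarrow> real mat set" where
  "Lambda n \<alpha> \<beta> \<gamma> = {\<alpha> \<cdot>\<^sub>m A + \<beta> \<cdot>\<^sub>m B + \<gamma> \<cdot>\<^sub>m C | A B C. placement n A B C}"

text \<open>\<open>B\<close> occupies the main diagonal, and \<open>\<alpha>\<close> is at \<open>(i, j)\<close> iff \<open>\<gamma>\<close> is at \<open>(j, i)\<close>.\<close>

definition Lambda_hat :: "nat \<Rightarrow> real \<Rightarrow> real \<Rightarrow> real \<Rightarrow> real mat set" where
  "Lambda_hat n \<alpha> \<beta> \<gamma> = {\<alpha> \<cdot>\<^sub>m A + \<beta> \<cdot>\<^sub>m B + \<gamma> \<cdot>\<^sub>m C | A B C.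
     placement n A B C \<and> B = 1\<^sub>m n \<and> mat_support A = (mat_support C)\<inverse>}"

definition max_permanent :: "nat \<Rightarrow> real \<Rightarrow> real \<Rightarrow> real \<Rightarrow> real" where
  "max_permanent n \<alpha> \<beta> \<gamma> = Max (permanent ` Lambda_hat n \<alpha> \<beta> \<gamma>)"

lemma Lambda_hat_subset: "Lambda_hat n \<alpha> \<beta> \<gamma> \<subseteq> Lambda n \<alpha> \<beta> \<gamma>"
  unfolding Lambda_hat_def Lambda_def by blast

lemma mat_support_perm_mat:
  assumes "p permutes {0..<n}"
  shows "mat_support (perm_mat n p) = {(i, p i) | i. i < n}"
proof -
  have "p i < n" if "i < n" for i
    using permutes_in_image[OF assms, of i] that by simp
  then show ?thesis
    by (auto simp: mat_support_def perm_mat_def split: if_splits)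
qed

lemma one_mat_perm_mat: "1\<^sub>m n = perm_mat n id"
  by (rule eq_matI) (auto simp: perm_mat_def)

lemma card_orbit_ge_3_iff:
  fixes s :: "nat \<Rightarrow> nat"
  assumes "s permutes {0..<n}"
  shows "3 \<le> card (orbit s i) \<longleftrightarrow> s i \<noteq> i \<and> s (s i) \<noteq> i"
proof -
  have perm: "permutation s"
    unfolding permutation_permutes by (intro exI[of _ "{0..<n}"] conjI assms) simp
  then have self: "i \<in> orbit s i"
    by (rule permutation_self_in_orbit)
  then have fin: "finite (orbit s i)"
    by (rule finite_orbit)
  have s1: "s i \<in> orbit s i" and s2: "s (s i) \<in> orbit s i"
    by (rule orbit.base, rule orbit.step[OF orbit.base])
  show ?thesis
  proof
    assume card: "3 \<le> card (orbit s i)"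
    have sub: "orbit s i \<subseteq> {i, s i}" if "s (s i) = i"
    proof
      fix x assume "x \<in> orbit s i"
      then show "x \<in> {i, s i}"
        by (induction rule: orbit.induct) (use that in auto)
    qed
    have "s (s i) \<noteq> i"
    proof
      assume "s (s i) = i"
      from card_mono[OF _ sub[OF this]] have "card (orbit s i) \<le> card {i, s i}"
        by simp
      also have "\<dots> \<le> 2"
        by (simp add: card_insert_if)
      finally show False using card by simp
    qed
    then show "s i \<noteq> i \<and> s (s i) \<noteq> i" by metis
  next
    assume *: "s i \<noteq> i \<and> s (s i) \<noteq> i"
    then have "s (s i) \<noteq> s i"
      using permutes_inj[OF assms] by (metis injD)
    with * have "card {i, s i, s (s i)} = 3"
      by (auto simp: card_insert_if)
    moreover have "card {i, s i, s (s i)} \<le> card (orbit s i)"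
      using fin self s1 s2 by (intro card_mono) auto
    ultimately show "3 \<le> card (orbit s i)" by simp
  qed
qed

lemma mem_mat_support_perm_mat:
  assumes "p permutes {0..<n}"
  shows "(i, j) \<in> mat_support (perm_mat n p) \<longleftrightarrow> i < n \<and> j = p i"
  unfolding mat_support_perm_mat[OF assms] by auto

lemma mat_support_inv:
  assumes s: "s permutes {0..<n}"
  shows "mat_support (perm_mat n (Hilbert_Choice.inv s)) = (mat_support (perm_mat n s))\<inverse>"
proof (rule Set.set_eqI, unfold split_paired_all)
  fix i j
  have "s j < n \<longleftrightarrow> j < n"
    using permutes_in_image[OF s, of j] by simp
  then show "(i, j) \<in> mat_support (perm_mat n (Hilbert_Choice.inv s)) \<longleftrightarrow>
      (i, j) \<in> (mat_support (perm_mat n s))\<inverse>"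
    unfolding converse_iff mem_mat_support_perm_mat[OF s]
      mem_mat_support_perm_mat[OF permutes_inv[OF s]]
    using permutes_inverses(1)[OF s, of i] permutes_inverses(2)[OF s, of j] by auto
qed

lemma perm_mat_eqI:
  assumes "p permutes {0..<n}" "q permutes {0..<n}"
    and "mat_support (perm_mat n p) = mat_support (perm_mat n q)"
  shows "perm_mat n p = perm_mat n q"
proof -
  have "p i = q i" if "i < n" for i
    using assms(3) that
    unfolding mat_support_perm_mat[OF assms(1)] mat_support_perm_mat[OF assms(2)] by auto
  then show ?thesis
    unfolding perm_mat_def by (intro cong_mat) auto
qed

lemma placement_inv_iff:
  assumes s: "s permutes {0..<n}"
  shows "placement n (perm_mat n (Hilbert_Choice.inv s)) (1\<^sub>m n) (perm_mat n s) \<longleftrightarrow>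
    (\<forall>i<n. 3 \<le> card (orbit s i))"
proof -
  let ?S = "mat_support (perm_mat n s)" and ?I = "mat_support (1\<^sub>m n :: real mat)"
  have less: "s i < n" if "i < n" for i
    using permutes_in_image[OF s, of i] that by simp
  have mem: "perm_mat n (Hilbert_Choice.inv s) \<in> permutation_matrices n"
    "1\<^sub>m n \<in> permutation_matrices n" "perm_mat n s \<in> permutation_matrices n"
    unfolding permutation_matrices_def one_mat_perm_mat
    using s permutes_inv[OF s] permutes_id[of "{0..<n}"] by blast+
  have S: "(i, j) \<in> ?S \<longleftrightarrow> i < n \<and> j = s i" and I: "(i, j) \<in> ?I \<longleftrightarrow> i < n \<and> j = i" for i j
    unfolding one_mat_perm_mat
    by (simp_all add: mem_mat_support_perm_mat s permutes_id)
  have "?I \<inter> ?S = {} \<longleftrightarrow> (\<forall>i<n. s i \<noteq> i)"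
    by (auto simp: set_eq_iff S I)
  moreover have "?S\<inverse> \<inter> ?I = {} \<longleftrightarrow> (\<forall>i<n. s i \<noteq> i)"
    by (auto simp: set_eq_iff S I)
  moreover have "?S\<inverse> \<inter> ?S = {} \<longleftrightarrow> (\<forall>i<n. s (s i) \<noteq> i)"
    using less by (auto simp: set_eq_iff S)
  ultimately show ?thesis
    unfolding placement_def mat_support_inv[OF s] card_orbit_ge_3_iff[OF s]
    using mem by auto
qed

text \<open>Equivalently, \<open>Lambda_hat\<close> consists of the matrices \<open>\<alpha> S\<^sup>-\<^sup>1 + \<beta> I + \<gamma> S\<close> with \<open>S\<close> the
  matrix of a permutation all of whose cycles have length at least 3.\<close>

lemma Lambda_hat_eq:
  "Lambda_hat n \<alpha> \<beta> \<gamma> =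
     {\<alpha> \<cdot>\<^sub>m perm_mat n (Hilbert_Choice.inv s) + \<beta> \<cdot>\<^sub>m 1\<^sub>m n + \<gamma> \<cdot>\<^sub>m perm_mat n s | s.
        s permutes {0..<n} \<and> (\<forall>i<n. 3 \<le> card (orbit s i))}"
proof (intro equalityI subsetI)
  fix M assume "M \<in> Lambda_hat n \<alpha> \<beta> \<gamma>"
  then obtain A C where M: "M = \<alpha> \<cdot>\<^sub>m A + \<beta> \<cdot>\<^sub>m 1\<^sub>m n + \<gamma> \<cdot>\<^sub>m C"
    and pl: "placement n A (1\<^sub>m n) C" and sup: "mat_support A = (mat_support C)\<inverse>"
    unfolding Lambda_hat_def by blast
  from pl obtain p s where p: "p permutes {0..<n}" "A = perm_mat n p"
    and s: "s permutes {0..<n}" "C = perm_mat n s"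
    unfolding placement_def permutation_matrices_def by blast
  have "A = perm_mat n (Hilbert_Choice.inv s)"
    using perm_mat_eqI[OF p(1) permutes_inv[OF s(1)]] sup
    by (simp add: p(2) s mat_support_inv)
  moreover from this pl s have "\<forall>i<n. 3 \<le> card (orbit s i)"
    using placement_inv_iff[OF s(1)] by simp
  ultimately show "M \<in> {\<alpha> \<cdot>\<^sub>m perm_mat n (Hilbert_Choice.inv s) + \<beta> \<cdot>\<^sub>m 1\<^sub>m n + \<gamma> \<cdot>\<^sub>m perm_mat n s | s.
        s permutes {0..<n} \<and> (\<forall>i<n. 3 \<le> card (orbit s i))}"
    using M s by (intro CollectI exI[of _ s]) simp
next
  fix M assume "M \<in> {\<alpha> \<cdot>\<^sub>m perm_mat n (Hilbert_Choice.inv s) + \<beta> \<cdot>\<^sub>m 1\<^sub>m n + \<gamma> \<cdot>\<^sub>m perm_mat n s | s.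
        s permutes {0..<n} \<and> (\<forall>i<n. 3 \<le> card (orbit s i))}"
  then obtain s where s: "s permutes {0..<n}" "\<forall>i<n. 3 \<le> card (orbit s i)"
    and M: "M = \<alpha> \<cdot>\<^sub>m perm_mat n (Hilbert_Choice.inv s) + \<beta> \<cdot>\<^sub>m 1\<^sub>m n + \<gamma> \<cdot>\<^sub>m perm_mat n s"
    by blast
  show "M \<in> Lambda_hat n \<alpha> \<beta> \<gamma>"
    unfolding Lambda_hat_def
    by (rule CollectI, rule exI[of _ "perm_mat n (Hilbert_Choice.inv s)"], rule exI[of _ "1\<^sub>m n"],
        rule exI[of _ "perm_mat n s"])
      (use s in \<open>simp add: M placement_inv_iff mat_support_inv\<close>)
qed

lemma finite_Lambda_hat: "finite (Lambda_hat n \<alpha> \<beta> \<gamma>)"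
proof -
  have "finite {s. s permutes {0..<n} \<and> (\<forall>i<n. 3 \<le> card (orbit s i))}"
    by (rule finite_subset[OF _ finite_permutations[of "{0..<n}"]]) auto
  then show ?thesis
    unfolding Lambda_hat_eq by (rule finite_image_set)
qed

lemma Lambda_hat_nonempty:
  assumes "3 \<le> n"
  shows "Lambda_hat n \<alpha> \<beta> \<gamma> \<noteq> {}"
proof -
  define s where "s i = (if i < n then if Suc i = n then 0 else Suc i else i)" for i
  have "bij_betw s {0..<n} {0..<n}"
    by (rule bij_betw_byWitness[where f' = "\<lambda>i. if i = 0 then n - 1 else i - 1"])
      (use assms in \<open>auto simp: s_def\<close>)
  then have s: "s permutes {0..<n}"
    by (rule bij_imp_permutes) (auto simp: s_def)
  have "3 \<le> card (orbit s i)" if "i < n" for i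
    unfolding card_orbit_ge_3_iff[OF s] using assms that by (auto simp: s_def)
  with s show ?thesis
    unfolding Lambda_hat_eq by blast
qed

text \<open>So the maximum is attained whenever \<open>n \<ge> 3\<close>.\<close>

lemma max_permanent_attained:
  assumes "3 \<le> n"
  shows "max_permanent n \<alpha> \<beta> \<gamma> \<in> permanent ` Lambda_hat n \<alpha> \<beta> \<gamma>"
    and "M \<in> Lambda_hat n \<alpha> \<beta> \<gamma> \<Longrightarrow> permanent M \<le> max_permanent n \<alpha> \<beta> \<gamma>"
  unfolding max_permanent_def
  using finite_Lambda_hat Lambda_hat_nonempty[OF assms] by (auto intro: Max_in)

end

theory Submission
  imports Defs
begin

text \<open>The permanent of \<open>\<alpha> S\<^sup>-\<^sup>1 + (\<gamma> - \<alpha>) I + \<gamma> S\<close> is a product over the cycles of the permutation.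
  On a cycle of length \<open>r \<ge> 3\<close> the matrix is cyclic tridiagonal; expanding it along a row
  leads to the recurrence \<open>x\<^sup>2 = (\<gamma> - \<alpha>) x + \<alpha> \<gamma>\<close> with roots \<open>\<gamma>\<close> and \<open>- \<alpha>\<close>, and its permanent is
  \<open>2 \<gamma>\<^sup>r + \<alpha>\<^sup>r + (- \<alpha>)\<^sup>r\<close>. This is at most \<open>(2 powr (1/3) * \<gamma>) ^ r\<close>, with equality for \<open>r = 3\<close>,
  so the bound is attained by permutations all of whose cycles have length 3.\<close>

section \<open>Permanents over arbitrary index sets\<close>

text \<open>The index set may be any set, so the part of a matrix living on one cycle is again a
  permanent without renumbering its indices.\<close>

definition permanent_on :: "'i set \<Rightarrow> ('i \<Rightarrow> 'i \<Rightarrow> 'a :: comm_semiring_1) \<Rightarrow> 'a" where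
  "permanent_on A w = (\<Sum>p | p permutes A. \<Prod>i\<in>A. w i (p i))"

lemma permanent_on_empty [simp]: "permanent_on {} w = 1"
  by (simp add: permanent_on_def)

lemma permanent_on_cong:
  assumes "\<And>i j. i \<in> A \<Longrightarrow> j \<in> A \<Longrightarrow> w i j = w' i j"
  shows "permanent_on A w = permanent_on A w'"
  unfolding permanent_on_def
  by (intro sum.cong prod.cong refl assms) (auto simp: permutes_in_image)

text \<open>Conjugation by \<open>e\<close> carries the permutations of \<open>A\<close> bijectively
  to those of \<open>B\<close>; \<open>?f p\<close> is this conjugate, extended by the identity
  outside \<open>B\<close>.\<close>

lemma permanent_on_reindex:
  assumes e: "bij_betw e A B"
  shows "permanent_on B w = permanent_on A (\<lambda>i j. w (e i) (e j))"
proof -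
  let ?f = "\<lambda>p x. if x \<in> B then e (p (inv_into A e x)) else x"
  have "permanent_on B w = (\<Sum>p | p permutes A. \<Prod>i\<in>B. w i (?f p i))"
    unfolding permanent_on_def by (rule sum.reindex_bij_betw[OF bij_betw_permutations[OF e], symmetric])
  also have "\<dots> = (\<Sum>p | p permutes A. \<Prod>i\<in>A. w (e i) (?f p (e i)))"
    by (intro sum.cong refl prod.reindex_bij_betw[OF e, symmetric])
  also have "\<dots> = permanent_on A (\<lambda>i j. w (e i) (e j))"
    unfolding permanent_on_def using e
    by (intro sum.cong prod.cong refl) (auto simp: bij_betw_inv_into_left dest: bij_betwE)
  finally show ?thesis .
qed

text \<open>Expansion along row \<open>a\<close>: instead of deleting column \<open>j\<close>, which would leave a non-square
  index set, column \<open>j\<close> is overwritten by column \<open>a\<close>.\<close>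

lemma permanent_on_insert:
  assumes "finite A" "a \<notin> A"
  shows "permanent_on (insert a A) w = w a a * permanent_on A w +
    (\<Sum>j\<in>A. w a j * permanent_on A (\<lambda>i k. w i (if k = j then a else k)))"
proof -
  \<comment> \<open>Each permutation of \<open>insert a A\<close> is
    \<open>transpose a j \<circ> q\<close> for unique \<open>j\<close> and
    \<open>q permutes A\<close>. It sends \<open>a\<close> to \<open>j\<close>, and takes the value
    \<open>a\<close> wherever \<open>q\<close> takes the value \<open>j\<close>.\<close>
  have "(\<Prod>i\<in>insert a A. w i ((transpose a j \<circ> q) i)) =
      w a j * (\<Prod>i\<in>A. w i (if q i = j then a else q i))" if "q permutes A" for j q
  proof -
    have "(\<Prod>i\<in>A. w i (transpose a j (q i))) = (\<Prod>i\<in>A. w i (if q i = j then a else q i))"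
      by (intro prod.cong refl arg_cong2[where f = w])
        (use assms that permutes_in_image[OF that] in \<open>force simp: transpose_def\<close>)
    then show ?thesis
      using assms that by (simp add: permutes_not_in)
  qed
  then have "permanent_on (insert a A) w =
      (\<Sum>j\<in>insert a A. w a j * permanent_on A (\<lambda>i k. w i (if k = j then a else k)))"
    unfolding permanent_on_def sum_over_permutations_insert[OF assms]
    by (simp add: sum_distrib_left)
  also have "permanent_on A (\<lambda>i k. w i (if k = a then a else k)) = permanent_on A w"
    by (rule permanent_on_cong) auto
  ultimately show ?thesis
    using assms by simp
qed

text \<open>A permutation taking some point of \<open>B\<close> into \<open>C\<close> contributes 0.
  The others map the finite set \<open>B\<close> onto itself, hence also \<open>C\<close>, and split
  uniquely as \<open>p \<circ> q\<close> with \<open>p\<close> acting on \<open>B\<close> and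
  \<open>q\<close> on \<open>C\<close>.\<close>

lemma permanent_on_block:
  assumes fin: "finite B" "finite C" and disj: "B \<inter> C = {}"
    and zero: "\<And>i j. i \<in> B \<Longrightarrow> j \<in> C \<Longrightarrow> w i j = 0"
  shows "permanent_on (B \<union> C) w = permanent_on B w * permanent_on C w"
proof -
  let ?P = "{p. p permutes B} \<times> {q. q permutes C}"
  let ?R = "{r. r permutes (B \<union> C) \<and> r ` B \<subseteq> B}"
  have bij: "bij_betw (\<lambda>(p, q). p \<circ> q) ?P ?R"
  proof (rule bij_betw_byWitness[where f' = "\<lambda>r. (restrict_id r B, restrict_id r C)"])
    show "\<forall>x\<in>?P. (\<lambda>r. (restrict_id r B, restrict_id r C)) ((\<lambda>(p, q). p \<circ> q) x) = x"
    proof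
      fix x assume "x \<in> ?P"
      then obtain p q where x: "x = (p, q)" and p: "p permutes B" and q: "q permutes C"
        by auto
      have "restrict_id (p \<circ> q) B = p"
        using disj by (auto simp: fun_eq_iff restrict_id_def permutes_not_in[OF p] permutes_not_in[OF q] disjoint_iff)
      moreover have "restrict_id (p \<circ> q) C x = q x" for x
      proof (cases "x \<in> C")
        case True
        then have "q x \<notin> B" using disj permutes_in_image[OF q, of x] by auto
        with True show ?thesis by (simp add: permutes_not_in[OF p])
      qed (simp add: permutes_not_in[OF q])
      ultimately show "(\<lambda>r. (restrict_id r B, restrict_id r C)) ((\<lambda>(p, q). p \<circ> q) x) = x"
        by (simp add: x fun_eq_iff)
    qed
    have R: "bij_betw r B B \<and> bij_betw r C C" if "r \<in> ?R" for r
    proof -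
      have inj: "inj_on r (B \<union> C)" and img: "r ` (B \<union> C) = B \<union> C"
        using that by (auto simp: permutes_inj_on permutes_image)
      have B: "r ` B = B"
        using that fin inj by (intro endo_inj_surj) (auto intro: inj_on_subset)
      have "r ` C = r ` (B \<union> C) - r ` B"
        using inj_on_image_set_diff[OF inj, of "B \<union> C" B] disj by (simp add: Un_Diff Diff_triv Int_commute)
      then have "r ` C = C"
        using disj B img by auto
      with B inj show ?thesis
        by (auto simp: bij_betw_def intro: inj_on_subset)
    qed
    show "(\<lambda>r. (restrict_id r B, restrict_id r C)) ` ?R \<subseteq> ?P"
      using R permutes_restrict_id by auto
    show "\<forall>r\<in>?R. (\<lambda>(p, q). p \<circ> q) (restrict_id r B, restrict_id r C) = r"
    proof
      fix r assume r: "r \<in> ?R"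
      have "restrict_id r B (restrict_id r C x) = r x" for x
      proof (cases "x \<in> C")
        case True
        then have "r x \<in> C" using R[OF r] by (auto simp: bij_betw_def)
        with True disj show ?thesis by (auto simp: restrict_id_def)
      next
        case False
        with r show ?thesis by (auto simp: restrict_id_def permutes_not_in)
      qed
      then show "(\<lambda>(p, q). p \<circ> q) (restrict_id r B, restrict_id r C) = r"
        by (simp add: fun_eq_iff)
    qed
    show "(\<lambda>(p, q). p \<circ> q) ` ?P \<subseteq> ?R"
    proof clarify
      fix p q assume p: "p permutes B" and q: "q permutes C"
      have "p \<circ> q permutes (B \<union> C)"
        by (intro permutes_compose permutes_subset[OF p] permutes_subset[OF q]) auto
      moreover have "(p \<circ> q) ` B \<subseteq> B"
        using disj by (auto simp: permutes_not_in[OF q] permutes_in_image[OF p] disjoint_iff)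
      ultimately show "p \<circ> q permutes (B \<union> C) \<and> (p \<circ> q) ` B \<subseteq> B" by simp
    qed
  qed
  have "permanent_on (B \<union> C) w = (\<Sum>r\<in>?R. \<Prod>i\<in>B \<union> C. w i (r i))"
    unfolding permanent_on_def
  proof (rule sum.mono_neutral_right)
    show "\<forall>r\<in>{p. p permutes (B \<union> C)} - ?R. (\<Prod>i\<in>B \<union> C. w i (r i)) = 0"
    proof
      fix r assume "r \<in> {p. p permutes (B \<union> C)} - ?R"
      then obtain i where "i \<in> B" "r i \<in> C"
        by (auto simp: image_subset_iff) (metis UnE UnI1 permutes_in_image)
      with fin zero show "(\<Prod>i\<in>B \<union> C. w i (r i)) = 0"
        by (intro prod_zero) auto
    qed
  qed (use fin in \<open>auto intro: finite_permutations\<close>)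
  also have "\<dots> = (\<Sum>(p, q)\<in>?P. \<Prod>i\<in>B \<union> C. w i ((p \<circ> q) i))"
    unfolding sum.reindex_bij_betw[OF bij, symmetric] by (simp add: case_prod_beta)
  also have "\<dots> = (\<Sum>(p, q)\<in>?P. (\<Prod>i\<in>B. w i (p i)) * (\<Prod>i\<in>C. w i (q i)))"
  proof (rule sum.cong[OF refl], clarify)
    fix p q assume p: "p permutes B" and q: "q permutes C"
    have "(\<Prod>i\<in>B. w i ((p \<circ> q) i)) = (\<Prod>i\<in>B. w i (p i))"
      using disj by (intro prod.cong) (auto simp: permutes_not_in[OF q] disjoint_iff)
    moreover have "(\<Prod>i\<in>C. w i ((p \<circ> q) i)) = (\<Prod>i\<in>C. w i (q i))"
    proof (rule prod.cong[OF refl])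
      fix i assume "i \<in> C"
      then have "q i \<notin> B" using disj permutes_in_image[OF q] by auto
      then show "w i ((p \<circ> q) i) = w i (q i)" by (simp add: permutes_not_in[OF p])
    qed
    ultimately show "(\<Prod>i\<in>B \<union> C. w i ((p \<circ> q) i)) = (\<Prod>i\<in>B. w i (p i)) * (\<Prod>i\<in>C. w i (q i))"
      using fin disj by (simp add: prod.union_disjoint)
  qed
  also have "\<dots> = permanent_on B w * permanent_on C w"
    unfolding permanent_on_def by (simp add: sum_product sum.cartesian_product)
  finally show ?thesis .
qed

lemma permanent_on_Union:
  assumes "finite F" "\<And>B. B \<in> F \<Longrightarrow> finite B" "disjoint F"
    and "\<And>B i j. B \<in> F \<Longrightarrow> i \<in> B \<Longrightarrow> j \<in> \<Union>F \<Longrightarrow> j \<notin> B \<Longrightarrow> w i j = 0"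
  shows "permanent_on (\<Union>F) w = (\<Prod>B\<in>F. permanent_on B w)"
  using assms
proof (induction F rule: finite_induct)
  case (insert B F)
  have disj: "B \<inter> \<Union>F = {}"
    using insert.prems(2) insert.hyps by (auto simp: disjoint_def disjnt_def pairwise_def)
  have "permanent_on (B \<union> \<Union>F) w = permanent_on B w * permanent_on (\<Union>F) w"
  proof (rule permanent_on_block)
    show "w i j = 0" if "i \<in> B" "j \<in> \<Union>F" for i j
      using insert.prems(3)[of B i j] that disj by auto
  qed (use insert disj in auto)
  moreover have "permanent_on (\<Union>F) w = (\<Prod>B\<in>F. permanent_on B w)"
  proof (rule insert.IH)
    show "w i j = 0" if "Ba \<in> F" "i \<in> Ba" "j \<in> \<Union>F" "j \<notin> Ba" for Ba i j
      using insert.prems(3)[of Ba i j] that by auto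
  qed (use insert.prems in \<open>auto simp: pairwise_insert\<close>)
  ultimately show ?case
    using insert.hyps by simp
qed simp

section \<open>Tridiagonal permanents\<close>

text \<open>There is no size parameter: restricting the same function to \<open>{..<k}\<close> gives
  every leading block.\<close>

definition tridiag :: "'a \<Rightarrow> 'a \<Rightarrow> 'a \<Rightarrow> nat \<Rightarrow> nat \<Rightarrow> 'a :: comm_ring_1" where
  "tridiag a b c i j = (if i = Suc j then a else if i = j then b else if j = Suc i then c else 0)"

text \<open>Row expansion overwrites columns, so its minors are tridiagonal except for one foreign
  column \<open>v\<close>. Choosing \<open>v j\<close> in that column forces the subdiagonal entry
  \<open>a\<close> in each of the \<open>k - j\<close> rows below and leaves the leading block of
  size \<open>j\<close>.\<close>

lemma permanent_on_tridiag_last_column: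
  "permanent_on {..<Suc k} (\<lambda>i j. if j = k then v i else tridiag a b c i j) =
    (\<Sum>j\<le>k. a ^ (k - j) * v j * permanent_on {..<j} (tridiag a b c))"
proof (induction k)
  case 0
  then show ?case by (simp add: lessThan_Suc permanent_on_insert)
next
  case (Suc k)
  let ?w = "\<lambda>i j. if j = Suc k then v i else tridiag a b c i j"
  have "permanent_on {..<Suc (Suc k)} ?w = v (Suc k) * permanent_on {..<Suc k} ?w +
     (\<Sum>j<Suc k. ?w (Suc k) j * permanent_on {..<Suc k} (\<lambda>i l. ?w i (if l = j then Suc k else l)))"
    by (subst lessThan_Suc, subst permanent_on_insert) auto
  also have "permanent_on {..<Suc k} ?w = permanent_on {..<Suc k} (tridiag a b c)"
    by (rule permanent_on_cong) auto
  also have "(\<Sum>j<Suc k. ?w (Suc k) j * permanent_on {..<Suc k} (\<lambda>i l. ?w i (if l = j then Suc k else l)))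
     = (\<Sum>j\<in>{k}. ?w (Suc k) j * permanent_on {..<Suc k} (\<lambda>i l. ?w i (if l = j then Suc k else l)))"
    by (rule sum.mono_neutral_right) (auto simp: tridiag_def)
  \<comment> \<open>Overwriting column \<open>k\<close> by the last column moves \<open>v\<close>
    one place to the left, which is the shape of the induction hypothesis.\<close>
  also have "permanent_on {..<Suc k} (\<lambda>i l. ?w i (if l = k then Suc k else l)) =
      permanent_on {..<Suc k} (\<lambda>i j. if j = k then v i else tridiag a b c i j)"
    by (rule permanent_on_cong) auto
  then have "(\<Sum>j\<in>{k}. ?w (Suc k) j * permanent_on {..<Suc k} (\<lambda>i l. ?w i (if l = j then Suc k else l)))
    = a * (\<Sum>j\<le>k. a ^ (k - j) * v j * permanent_on {..<j} (tridiag a b c))"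
    by (simp add: Suc.IH) (simp add: tridiag_def)
  also have "\<dots> = (\<Sum>j\<le>k. a ^ (Suc k - j) * v j * permanent_on {..<j} (tridiag a b c))"
    unfolding sum_distrib_left by (intro sum.cong) (auto simp: Suc_diff_le mult_ac)
  finally show ?case
    by (simp add: add.commute)
qed

lemma permanent_on_tridiag_1: "permanent_on {..<Suc 0} (tridiag a b c) = b"
  by (simp add: lessThan_Suc permanent_on_insert tridiag_def)

text \<open>In \<open>permanent_on_tridiag_last_column\<close>, let \<open>v\<close> be the
  tridiagonal column itself: only its entries in rows \<open>k\<close> and \<open>Suc k\<close>
  survive.\<close>

lemma permanent_on_tridiag_Suc_Suc:
  "permanent_on {..<Suc (Suc k)} (tridiag a b c) =
    b * permanent_on {..<Suc k} (tridiag a b c) + a * c * permanent_on {..<k} (tridiag a b c)"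
proof -
  have "permanent_on {..<Suc (Suc k)} (tridiag a b c) =
     permanent_on {..<Suc (Suc k)} (\<lambda>i j. if j = Suc k then tridiag a b c i (Suc k) else tridiag a b c i j)"
    by (rule permanent_on_cong) auto
  also have "\<dots> = (\<Sum>j\<le>Suc k. a ^ (Suc k - j) * tridiag a b c j (Suc k) * permanent_on {..<j} (tridiag a b c))"
    by (rule permanent_on_tridiag_last_column)
  also have "\<dots> = (\<Sum>j\<in>{k, Suc k}. a ^ (Suc k - j) * tridiag a b c j (Suc k) * permanent_on {..<j} (tridiag a b c))"
    by (rule sum.mono_neutral_right) (auto simp: tridiag_def)
  also have "\<dots> = b * permanent_on {..<Suc k} (tridiag a b c) + a * c * permanent_on {..<k} (tridiag a b c)"
    by (simp add: tridiag_def)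
  finally show ?thesis .
qed

text \<open>This is the minor met when a cyclic matrix is expanded. Its last column lives in rows
  \<open>0\<close> and \<open>k\<close>, distinct since \<open>0 < k\<close>; row \<open>0\<close>
  contributes a pure power of \<open>a\<close>.\<close>

lemma permanent_on_tridiag_corner:
  assumes "0 < k"
  shows "permanent_on {..<Suc k} (\<lambda>i j. if j = k then if i = k then c else if i = 0 then a else 0
      else tridiag a b c i j) = c * permanent_on {..<k} (tridiag a b c) + a ^ Suc k"
proof -
  let ?v = "\<lambda>i. if i = k then c else if i = 0 then a else 0"
  have "permanent_on {..<Suc k} (\<lambda>i j. if j = k then ?v i else tridiag a b c i j) =
    (\<Sum>j\<le>k. a ^ (k - j) * ?v j * permanent_on {..<j} (tridiag a b c))"
    by (rule permanent_on_tridiag_last_column)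
  also have "\<dots> = (\<Sum>j\<in>{0, k}. a ^ (k - j) * ?v j * permanent_on {..<j} (tridiag a b c))"
    by (rule sum.mono_neutral_right) auto
  finally show ?thesis
    using assms by simp
qed

text \<open>Reversing the index order exchanges sub- and superdiagonal, so one corner minor can be
  reduced to the other.\<close>

lemma permanent_on_reverse:
  "permanent_on {..<Suc k} w = permanent_on {..<Suc k} (\<lambda>i j. w (k - i) (k - j))"
  by (rule permanent_on_reindex, rule bij_betw_byWitness[where f' = "\<lambda>i. k - i"]) auto

lemma tridiag_reverse:
  assumes "i < Suc k" "j < Suc k"
  shows "tridiag a b c (k - i) (k - j) = tridiag c b a i j"
proof -
  have "k - i = Suc (k - j) \<longleftrightarrow> j = Suc i" "k - i = k - j \<longleftrightarrow> i = j" "k - j = Suc (k - i) \<longleftrightarrow> i = Suc j"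
    using assms by arith+
  then show ?thesis
    unfolding tridiag_def by (simp only:) simp
qed

lemma permanent_on_tridiag_swap:
  "permanent_on {..<k} (tridiag c b a) = permanent_on {..<k} (tridiag a b c)"
proof (cases k)
  case (Suc m)
  show ?thesis
    unfolding Suc permanent_on_reverse[of m "tridiag c b a"]
    by (rule permanent_on_cong) (simp add: tridiag_reverse)
qed simp

section \<open>The permanent of a single cycle\<close>

text \<open>This is \<open>a S^-1 + b I + c S\<close> for the cyclic shift \<open>S\<close> of
  \<open>{..<r}\<close>. The sum of indicators matches \<open>perm_weight\<close> term by
  term.\<close>

definition cyclic_tridiag :: "nat \<Rightarrow> 'a \<Rightarrow> 'a \<Rightarrow> 'a \<Rightarrow> nat \<Rightarrow> nat \<Rightarrow> 'a :: comm_ring_1" where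
  "cyclic_tridiag r a b c i j =
    a * of_bool (i = Suc j mod r) + b * of_bool (i = j) + c * of_bool (j = Suc i mod r)"

text \<open>Splits off the last row and column. With \<open>k > 0\<close> the size is at least 3, so
  the corner entries do not collide with the off-diagonals.\<close>

lemma cyclic_tridiag_eq:
  assumes "k > 0"
  shows "\<lbrakk>i < Suc k; j < Suc k\<rbrakk> \<Longrightarrow> cyclic_tridiag (Suc (Suc k)) a b c i j = tridiag a b c i j"
    and "i < Suc k \<Longrightarrow> cyclic_tridiag (Suc (Suc k)) a b c i (Suc k) =
      (if i = k then c else if i = 0 then a else 0)"
    and "j < Suc k \<Longrightarrow> cyclic_tridiag (Suc (Suc k)) a b c (Suc k) j =
      (if j = k then a else if j = 0 then c else 0)"
    and "cyclic_tridiag (Suc (Suc k)) a b c (Suc k) (Suc k) = b"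
  using assms by (auto simp: cyclic_tridiag_def tridiag_def mod_Suc)

text \<open>The last row has the entries \<open>c\<close>, \<open>a\<close>, \<open>b\<close> in
  columns \<open>0\<close>, \<open>k\<close>, \<open>Suc k\<close>. Each of the first two leaves a
  corner minor: together these give the factor 2 and the two pure powers, which come from the two
  full rotations.\<close>

lemma permanent_on_cyclic_tridiag:
  assumes k: "0 < k"
  shows "permanent_on {..<Suc (Suc k)} (cyclic_tridiag (Suc (Suc k)) a b c) =
    b * permanent_on {..<Suc k} (tridiag a b c) + 2 * a * c * permanent_on {..<k} (tridiag a b c)
      + a ^ Suc (Suc k) + c ^ Suc (Suc k)"
proof -
  let ?w = "cyclic_tridiag (Suc (Suc k)) a b c"
  let ?m = "\<lambda>j. permanent_on {..<Suc k} (\<lambda>i l. ?w i (if l = j then Suc k else l))"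
  have "permanent_on {..<Suc (Suc k)} ?w = ?w (Suc k) (Suc k) * permanent_on {..<Suc k} ?w +
     (\<Sum>j<Suc k. ?w (Suc k) j * ?m j)"
    by (subst lessThan_Suc, subst permanent_on_insert) auto
  also have "?w (Suc k) (Suc k) = b"
    by (rule cyclic_tridiag_eq(4)[OF k])
  also have "permanent_on {..<Suc k} ?w = permanent_on {..<Suc k} (tridiag a b c)"
    by (rule permanent_on_cong) (auto simp: cyclic_tridiag_eq[OF k])
  also have "(\<Sum>j<Suc k. ?w (Suc k) j * ?m j) = (\<Sum>j\<in>{0, k}. ?w (Suc k) j * ?m j)"
    by (rule sum.mono_neutral_right) (auto simp: cyclic_tridiag_eq[OF k])
  also have "\<dots> = c * ?m 0 + a * ?m k"
    using k by (simp add: cyclic_tridiag_eq[OF k])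
  also have "?m k = permanent_on {..<Suc k} (\<lambda>i j. if j = k then if i = k then c else if i = 0 then a else 0
      else tridiag a b c i j)"
    by (rule permanent_on_cong) (auto simp: cyclic_tridiag_eq[OF k])
  also have "\<dots> = c * permanent_on {..<k} (tridiag a b c) + a ^ Suc k"
    by (rule permanent_on_tridiag_corner[OF k])
  \<comment> \<open>Here column \<open>0\<close> is the overwritten one; reversal moves it to the
    end and exchanges \<open>a\<close> with \<open>c\<close>.\<close>
  also have "?m 0 = permanent_on {..<Suc k} (\<lambda>i j. if j = k then if i = k then a else if i = 0 then c else 0
      else tridiag c b a i j)"
    unfolding permanent_on_reverse[of k "\<lambda>i l. ?w i (if l = 0 then Suc k else l)"]
    using k by (intro permanent_on_cong) (auto simp: cyclic_tridiag_eq[OF k] tridiag_reverse)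
  also have "\<dots> = a * permanent_on {..<k} (tridiag a b c) + c ^ Suc k"
    unfolding permanent_on_tridiag_corner[OF k] permanent_on_tridiag_swap[of k c b a] ..
  finally show ?thesis
    by (simp add: algebra_simps)
qed

text \<open>For \<open>b = c - a\<close> the recurrence of the tridiagonal permanents has characteristic roots
  \<open>c\<close> and \<open>- a\<close>.\<close>

lemma permanent_on_tridiag_sum:
  "permanent_on {..<Suc k} (tridiag a (c - a) c) + a * permanent_on {..<k} (tridiag a (c - a) c)
    = c ^ Suc k"
proof (induction k)
  case 0
  show ?case by (simp add: permanent_on_tridiag_1)
next
  case (Suc k)
  then show ?case
    unfolding permanent_on_tridiag_Suc_Suc power_Suc[of c "Suc k"] Suc.IH[symmetric]
    by (simp add: algebra_simps)
qed

lemma permanent_on_tridiag_diff: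
  "permanent_on {..<Suc k} (tridiag a (c - a) c) - c * permanent_on {..<k} (tridiag a (c - a) c)
    = (- a) ^ Suc k"
proof (induction k)
  case 0
  show ?case by (simp add: permanent_on_tridiag_1)
next
  case (Suc k)
  then show ?case
    unfolding permanent_on_tridiag_Suc_Suc power_Suc[of "- a" "Suc k"] Suc.IH[symmetric]
    by (simp add: algebra_simps)
qed

lemma permanent_on_cyclic_tridiag_diff:
  assumes "3 \<le> r"
  shows "permanent_on {..<r} (cyclic_tridiag r a (c - a) c) = 2 * c ^ r + a ^ r + (- a) ^ r"
proof -
  define k where "k = r - 2"
  have r: "r = Suc (Suc k)" and k: "0 < k"
    using assms by (auto simp: k_def)
  let ?f = "\<lambda>m. permanent_on {..<m} (tridiag a (c - a) c)"
  have "permanent_on {..<r} (cyclic_tridiag r a (c - a) c) =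
      (c - a) * ?f (Suc k) + 2 * a * c * ?f k + a ^ r + c ^ r"
    unfolding r by (rule permanent_on_cyclic_tridiag[OF k])
  \<comment> \<open>Regrouped so that each bracket is a combination on which the recurrence acts as
    multiplication by one root, \<open>c\<close> or \<open>- a\<close>.\<close>
  also have "(c - a) * ?f (Suc k) + 2 * a * c * ?f k =
      c * (?f (Suc k) + a * ?f k) + (- a) * (?f (Suc k) - c * ?f k)"
    by (simp add: algebra_simps)
  also have "\<dots> = c ^ r + (- a) ^ r"
    unfolding permanent_on_tridiag_sum permanent_on_tridiag_diff r by simp
  finally show ?thesis
    by simp
qed

section \<open>Factorisation over the cycles of a permutation\<close>

text \<open>The entries of \<open>a S^-1 + b I + c S\<close>; the condition \<open>i = s j\<close>
  avoids mentioning the inverse of \<open>s\<close>.\<close>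

definition perm_weight :: "('i \<Rightarrow> 'i) \<Rightarrow> 'a \<Rightarrow> 'a \<Rightarrow> 'a \<Rightarrow> 'i \<Rightarrow> 'i \<Rightarrow> 'a :: comm_ring_1" where
  "perm_weight s a b c i j = a * of_bool (i = s j) + b * of_bool (i = j) + c * of_bool (j = s i)"

text \<open>Numbering the orbit by the iterates of \<open>s\<close> at \<open>x\<close> turns
  \<open>s\<close> into the shift modulo the cycle length.\<close>

lemma permanent_on_orbit:
  assumes s: "permutation s" and card: "3 \<le> card (orbit s x)"
  shows "permanent_on (orbit s x) (perm_weight s a (c - a) c) =
    2 * c ^ card (orbit s x) + a ^ card (orbit s x) + (- a) ^ card (orbit s x)"
proof -
  \<comment> \<open>The first positive return time of \<open>x\<close>.\<close>
  define r where "r = funpow_dist1 s x x"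
  define e where "e k = (s ^^ k) x" for k
  have x: "x \<in> orbit s x"
    using s by (rule permutation_self_in_orbit)
  have bij: "bij_betw e {..<r} (orbit s x)"
    using inj_on_funpow_dist1[OF x] orbit_conv_funpow_dist1[OF x]
    unfolding e_def by (simp add: bij_betw_def r_def atLeast0LessThan)
  then have r: "card (orbit s x) = r"
    using bij_betw_same_card by fastforce
  have sr: "(s ^^ r) x = x"
    unfolding r_def by (rule funpow_dist1_prop[OF x])
  have s_e: "s (e k) = e (Suc k mod r)" for k
    using funpow_mod_eq[OF sr, of "Suc k"] by (simp add: e_def)
  have inj: "e i = e j \<longleftrightarrow> i = j" if "i < r" "j < r" for i j
    using bij that by (auto simp: bij_betw_def inj_on_def)
  have "permanent_on (orbit s x) (perm_weight s a (c - a) c) =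
      permanent_on {..<r} (cyclic_tridiag r a (c - a) c)"
    unfolding permanent_on_reindex[OF bij]
    by (rule permanent_on_cong) (auto simp: perm_weight_def cyclic_tridiag_def s_e inj)
  also have "\<dots> = 2 * c ^ r + a ^ r + (- a) ^ r"
    using card r by (intro permanent_on_cyclic_tridiag_diff) simp
  finally show ?thesis
    by (simp add: r)
qed

lemma orbit_mem_eq:
  assumes "permutation s" "y \<in> orbit s x"
  shows "orbit s y = orbit s x"
proof -
  have "cyclic_on s (orbit s x)"
    using assms(1) unfolding cyclic_on_def by (auto intro: bexI[of _ x] permutation_self_in_orbit)
  then show ?thesis
    using assms(2) orbit_cyclic_eq3 by metis
qed

context
  fixes s :: "'i \<Rightarrow> 'i" and A :: "'i set"
  assumes finite: "finite A" and s: "s permutes A"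
begin

lemma permutation_s: "permutation s"
  using finite s by (auto simp: permutation_permutes)

lemma Union_orbits: "\<Union> (orbit s ` A) = A"
  using permutes_orbit_subset[OF s] permutation_self_in_orbit[OF permutation_s] by blast

lemma disjoint_orbits: "disjoint (orbit s ` A)"
  unfolding disjoint_def using orbit_mem_eq[OF permutation_s] by blast

lemma finite_orbits: "B \<in> orbit s ` A \<Longrightarrow> finite B"
  using Union_orbits finite by (metis Sup_upper finite_subset)

lemma card_eq_sum_orbits: "card A = (\<Sum>B\<in>orbit s ` A. card B)"
  using card_Union_disjoint[OF disjoint_orbits finite_orbits] Union_orbits by simp

text \<open>Multiplies estimates of the form \<open>x ^ length\<close> for the single cycles into
  one power of \<open>x\<close>.\<close>

lemma prod_orbits_power: "(\<Prod>B\<in>orbit s ` A. x ^ card B) = x ^ card A"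
  unfolding card_eq_sum_orbits power_sum ..

text \<open>A nonzero entry at \<open>(i, j)\<close> puts \<open>i\<close> and \<open>j\<close> on
  the same orbit, so the orbits are the blocks of a block diagonal matrix.\<close>

lemma permanent_on_perm_weight:
  assumes "\<And>x. x \<in> A \<Longrightarrow> 3 \<le> card (orbit s x)"
  shows "permanent_on A (perm_weight s a (c - a) c) =
    (\<Prod>B\<in>orbit s ` A. 2 * c ^ card B + a ^ card B + (- a) ^ card B)"
proof -
  have "permanent_on (\<Union> (orbit s ` A)) (perm_weight s a (c - a) c) =
      (\<Prod>B\<in>orbit s ` A. permanent_on B (perm_weight s a (c - a) c))"
  proof (rule permanent_on_Union)
    fix B i j assume B: "B \<in> orbit s ` A" "i \<in> B" and j: "j \<notin> B"
    have B_eq: "B = orbit s i"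
      using B orbit_mem_eq[OF permutation_s] by auto
    have "i \<noteq> s j"
    proof
      assume "i = s j"
      then have "i \<in> orbit s j" by (simp add: orbit.base)
      with j show False
        using orbit_mem_eq[OF permutation_s] permutation_self_in_orbit[OF permutation_s] B_eq by metis
    qed
    moreover have "j \<noteq> i" "j \<noteq> s i"
      using B j B_eq orbit.base[of s i] by auto
    ultimately show "perm_weight s a (c - a) c i j = 0"
      by (simp add: perm_weight_def)
  qed (use finite finite_orbits disjoint_orbits in auto)
  also have "\<dots> = (\<Prod>B\<in>orbit s ` A. 2 * c ^ card B + a ^ card B + (- a) ^ card B)"
    using assms by (intro prod.cong) (auto intro: permanent_on_orbit[OF permutation_s])
  finally show ?thesis
    by (simp add: Union_orbits)
qed

end

section \<open>Passage from matrices to weights, and the bound for one cycle\<close>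

lemma permanent_eq_permanent_on:
  assumes s: "s permutes {0..<n}"
  shows "permanent (a \<cdot>\<^sub>m perm_mat n (Hilbert_Choice.inv s) + b \<cdot>\<^sub>m 1\<^sub>m n + c \<cdot>\<^sub>m perm_mat n s) =
    permanent_on {0..<n} (perm_weight s a b c)"
proof -
  let ?M = "a \<cdot>\<^sub>m perm_mat n (Hilbert_Choice.inv s) + b \<cdot>\<^sub>m 1\<^sub>m n + c \<cdot>\<^sub>m perm_mat n s"
  have "permanent ?M = permanent_on {0..<n} (\<lambda>i j. ?M $$ (i, j))"
    by (simp add: permanent_def permanent_on_def perm_mat_def)
  also have "\<dots> = permanent_on {0..<n} (perm_weight s a b c)"
  proof (rule permanent_on_cong)
    fix i j assume "i \<in> {0..<n}" "j \<in> {0..<n}"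
    moreover have "j = Hilbert_Choice.inv s i \<longleftrightarrow> i = s j"
      using permutes_inv_eq[OF s] by metis
    ultimately show "?M $$ (i, j) = perm_weight s a b c i j"
      by (simp add: perm_mat_def perm_weight_def)
  qed
  finally show ?thesis .
qed

text \<open>Only cycles of length 4 use the full strength of the hypothesis on \<open>a\<close>.\<close>

lemma cycle_bound:
  fixes a c :: real
  assumes a: "0 \<le> a" and ac: "a \<le> (2 powr (1/3) - 1) powr (1/4) * c" and c: "0 < c" and r: "3 \<le> r"
  shows "2 * c ^ r + a ^ r + (- a) ^ r \<le> (2 powr (1/3) * c) ^ r"
proof -
  define u :: real where "u = 2 powr (1/3)"
  have u3: "u ^ 3 = 2"
    unfolding u_def by (simp add: powr_power)
  have u_gt: "1 < u"
    unfolding u_def by simp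
  have u_le: "u \<le> 2"
    unfolding u_def using powr_mono[of "1/3" 1 "2::real"] by simp
  \<comment> \<open>The claim is homogeneous in \<open>a\<close> and \<open>c\<close>, so only this
    ratio matters.\<close>
  define t where "t = a / c"
  have t: "0 \<le> t" "a = t * c"
    using a c by (auto simp: t_def)
  have "t \<le> (u - 1) powr (1/4)"
    using ac c by (simp add: t_def u_def divide_le_eq)
  then have "t ^ 4 \<le> ((u - 1) powr (1/4)) ^ 4"
    using t by (intro power_mono)
  also have "\<dots> = u - 1"
    using u_gt by (simp add: powr_power)
  finally have t4: "t ^ 4 \<le> u - 1" .
  have t1: "t \<le> 1"
  proof (rule ccontr)
    assume "\<not> t \<le> 1"
    then have "1 < t ^ 4" by (intro one_less_power) auto
    with t4 u_le show False by simp
  qed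
  have "2 + t ^ r + (- t) ^ r \<le> u ^ r"
  proof (cases "even r")
    case False
    \<comment> \<open>For odd length the two powers of \<open>t\<close> cancel, leaving 2.\<close>
    then have "2 + t ^ r + (- t) ^ r = u ^ 3"
      using u3 by (simp add: power_minus_odd)
    also have "\<dots> \<le> u ^ r"
      using u_gt r by (intro power_increasing) auto
    finally show ?thesis .
  next
    case True
    show ?thesis
    proof (cases "r = 4")
      case True
      \<comment> \<open>The claim becomes \<open>2 + 2 * t ^ 4 \<le> 2 * u\<close>, which is
        \<open>t4\<close>.\<close>
      have "u ^ 4 = 2 * u"
        using u3 by (simp add: eval_nat_numeral)
      then show ?thesis
        using t4 True by simp
    next
      case False
      \<comment> \<open>From length 6 on, the crude estimate \<open>t \<le> 1\<close> suffices,
        because \<open>u ^ 6 = 4\<close>.\<close>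
      with r \<open>even r\<close> have "6 \<le> r" by presburger
      have "2 + t ^ r + (- t) ^ r \<le> 4"
        using \<open>even r\<close> t t1 by (simp add: power_le_one)
      also have "4 = u ^ 6"
        using u3 power_mult[of u 3 2] by simp
      also have "\<dots> \<le> u ^ r"
        using u_gt \<open>6 \<le> r\<close> by (intro power_increasing) auto
      finally show ?thesis .
    qed
  qed
  then have "(2 + t ^ r + (- t) ^ r) * c ^ r \<le> u ^ r * c ^ r"
    using c by (intro mult_right_mono) auto
  moreover have "(- a) ^ r = (- t) ^ r * c ^ r"
    unfolding t(2) by (metis mult_minus_left power_mult_distrib)
  ultimately show ?thesis
    unfolding u_def[symmetric] by (simp add: t(2) power_mult_distrib algebra_simps)
qed

section \<open>The extremal permutation and the maximum\<close>

text \<open>The witness rotates each block \<open>3 * q, 3 * q + 1, 3 * q + 2\<close>.\<close>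

lemma three_cycles_permutation:
  fixes n :: nat
  assumes "3 dvd n"
  obtains s where "s permutes {0..<n}" "\<And>i. i < n \<Longrightarrow> card (orbit s i) = 3"
proof -
  define s :: "nat \<Rightarrow> nat" where
    "s i = (if i < n then if i mod 3 = 2 then i - 2 else Suc i else i)" for i
  obtain m where n: "n = 3 * m"
    using assms by blast
  have s_eq: "s (3 * q) = 3 * q + 1" "s (3 * q + 1) = 3 * q + 2" "s (3 * q + 2) = 3 * q" if "q < m" for q
    using that by (auto simp: s_def n mod_Suc)
  have cases3: "\<exists>q<m. i = 3 * q \<or> i = 3 * q + 1 \<or> i = 3 * q + 2" if "i < n" for i
    using that unfolding n by presburger
  have s_less: "s i < n" if "i < n" for i
    using cases3[OF that] s_eq by (auto simp: n)
  have s3: "s (s (s i)) = i" for i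
  proof (cases "i < n")
    case True
    with cases3[of i] s_eq show ?thesis by auto
  qed (simp add: s_def)
  have "bij_betw s {0..<n} {0..<n}"
    \<comment> \<open>Since the third iterate of \<open>s\<close> is the identity, \<open>s\<close>
      applied twice is its inverse.\<close>
    by (rule bij_betw_byWitness[where f' = "\<lambda>i. s (s i)"]) (auto simp: s3 s_less)
  then have s: "s permutes {0..<n}"
    by (rule bij_imp_permutes) (auto simp: s_def)
  have "card (orbit s i) = 3" if "i < n" for i
  proof -
    have ne: "s i \<noteq> i"
      using that by (auto simp: s_def)
    have "s (s i) \<noteq> i"
    proof
      assume "s (s i) = i"
      with s3[of i] ne show False by simp
    qed
    with ne have "3 \<le> card (orbit s i)"
      using card_orbit_ge_3_iff[OF s] by simp
    moreover have "orbit s i \<subseteq> {i, s i, s (s i)}"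
    proof
      fix x assume "x \<in> orbit s i"
      then show "x \<in> {i, s i, s (s i)}"
        by (induction rule: orbit.induct) (auto simp: s3)
    qed
    then have "card (orbit s i) \<le> card {i, s i, s (s i)}"
      by (rule card_mono[rotated]) simp
    then have "card (orbit s i) \<le> 3"
      by (rule order_trans) (simp add: card_insert_if)
    ultimately show ?thesis by simp
  qed
  with s show ?thesis ..
qed

theorem theorem5:
  fixes \<alpha> \<gamma> :: real and n :: nat
  assumes "\<alpha> \<noteq> 0" and "\<gamma> \<noteq> 0"
    and "0 \<le> \<alpha>" and "\<alpha> \<le> (2 powr (1/3) - 1) powr (1/4) * \<gamma>"
    and "0 < n" and "3 dvd n"
  shows "max_permanent n \<alpha> (\<gamma> - \<alpha>) \<gamma> = 2 ^ (n div 3) * \<gamma> ^ n"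
proof -
  let ?M = "\<lambda>s. \<alpha> \<cdot>\<^sub>m perm_mat n (Hilbert_Choice.inv s) + (\<gamma> - \<alpha>) \<cdot>\<^sub>m 1\<^sub>m n + \<gamma> \<cdot>\<^sub>m perm_mat n s"
  let ?g = "\<lambda>r. 2 * \<gamma> ^ r + \<alpha> ^ r + (- \<alpha>) ^ r"
  \<comment> \<open>Otherwise the upper bound on \<open>\<alpha>\<close> would be nonpositive,
    whereas the hypotheses make \<open>\<alpha>\<close> positive.\<close>
  have \<gamma>: "0 < \<gamma>"
  proof (rule ccontr)
    assume "\<not> 0 < \<gamma>"
    then have "(2 powr (1/3) - 1) powr (1/4) * \<gamma> \<le> 0"
      by (intro mult_nonneg_nonpos) auto
    with assms show False by simp
  qed
  have per: "permanent (?M s) = (\<Prod>B\<in>orbit s ` {0..<n}. ?g (card B))"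
    if "s permutes {0..<n}" "\<forall>i<n. 3 \<le> card (orbit s i)" for s
    unfolding permanent_eq_permanent_on[OF that(1)]
    using that by (intro permanent_on_perm_weight) auto
  have pow: "(2 powr (1/3) * \<gamma>) ^ n = 2 ^ (n div 3) * \<gamma> ^ n"
  proof -
    have "((2::real) powr (1/3)) ^ n = ((2 powr (1/3)) ^ 3) ^ (n div 3)"
      using \<open>3 dvd n\<close> by (simp flip: power_mult)
    also have "((2::real) powr (1/3)) ^ 3 = 2"
      by (simp add: powr_power)
    finally show ?thesis
      by (simp add: power_mult_distrib)
  qed
  have upper: "permanent M \<le> 2 ^ (n div 3) * \<gamma> ^ n" if "M \<in> Lambda_hat n \<alpha> (\<gamma> - \<alpha>) \<gamma>" for M
  proof -
    from that obtain s where s: "s permutes {0..<n}" "\<forall>i<n. 3 \<le> card (orbit s i)" and M: "M = ?M s"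
      unfolding Lambda_hat_eq by blast
    have "permanent M = (\<Prod>B\<in>orbit s ` {0..<n}. ?g (card B))"
      unfolding M by (rule per[OF s])
    also have "\<dots> \<le> (\<Prod>B\<in>orbit s ` {0..<n}. (2 powr (1/3) * \<gamma>) ^ card B)"
    \<comment> \<open>Multiplying the cycle bounds requires nonnegative factors as well.\<close>
    proof (rule prod_mono, rule conjI)
      fix B assume "B \<in> orbit s ` {0..<n}"
      then have "3 \<le> card B" using s by auto
      then show "?g (card B) \<le> (2 powr (1/3) * \<gamma>) ^ card B"
        using assms \<gamma> by (intro cycle_bound) auto
      \<comment> \<open>So the two powers of \<open>\<alpha>\<close> have a nonnegative sum,
        whatever the parity.\<close>
      have "\<bar>(- \<alpha>) ^ card B\<bar> \<le> \<alpha> ^ card B"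
        using \<open>0 \<le> \<alpha>\<close> by (simp add: power_abs)
      then show "0 \<le> ?g (card B)"
        using \<gamma> by (smt (verit) zero_less_power)
    qed
    also have "\<dots> = (2 powr (1/3) * \<gamma>) ^ n"
      using prod_orbits_power[OF _ s(1)] by simp
    finally show ?thesis
      by (simp add: pow)
  qed
  obtain s where s: "s permutes {0..<n}" "\<And>i. i < n \<Longrightarrow> card (orbit s i) = 3"
    using three_cycles_permutation[OF \<open>3 dvd n\<close>] by blast
  have "?M s \<in> Lambda_hat n \<alpha> (\<gamma> - \<alpha>) \<gamma>"
    unfolding Lambda_hat_eq using s by force
  moreover have "permanent (?M s) = 2 ^ (n div 3) * \<gamma> ^ n"
  proof -
    have "permanent (?M s) = (\<Prod>B\<in>orbit s ` {0..<n}. ?g (card B))"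
      using s by (intro per) auto
    \<comment> \<open>On a cycle of length 3 the cubes of \<open>\<alpha>\<close> and
      \<open>- \<alpha>\<close> cancel, so the cycle bound is an equality.\<close>
    also have "\<dots> = (\<Prod>B\<in>orbit s ` {0..<n}. (2 powr (1/3) * \<gamma>) ^ card B)"
      using s by (intro prod.cong) (auto simp: power_mult_distrib powr_power)
    also have "\<dots> = (2 powr (1/3) * \<gamma>) ^ n"
      using prod_orbits_power[OF _ s(1)] by simp
    finally show ?thesis
      by (simp add: pow)
  qed
  ultimately show ?thesis
    unfolding max_permanent_def using upper finite_Lambda_hat
    by (intro Max_eqI) (auto intro: rev_image_eqI)
qed

end
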